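(* If $\mathcal{M}$ and $\mathcal{N}$ are compact metric probability spaces, then $$d_{\mathrm{CI}}(\mathrm{DR}(\mathcal{M}),\mathrm{DR}(\mathcal{N}))\le 2\cdot d_{\mathrm{GHP}}(\mathcal{M},\mathcal{N}).$$
   Context: Hierarchical clusterings. A clustering of a set $X$ is a set of non-empty, pairwise disjoint subsets of $X$. $\mathsf{C}(X)$ is the poset of clusterings, where $S\preceq T$ if every $A\in S$ is contained in some $B\in T$. An $n$-parameter hierarchical clustering (HC) of $X$ is an order-preserving map $H:P\to\mathsf{C}(X)$, where $P=I_1\times\dots\times I_n$ (product order) and each $I_j$ is an interval of $\mathbb{R}$ or of $\mathbb{R}^{\mathrm{op}}$ (opposite order). Its extension $\bar H:\mathbb{R}^n\to\mathsf{C}(X)$: let $P'$ be obtained by replacing each $I_j\subseteq\mathbb{R}^{\mathrm{op}}$ by $-I_j\subseteq\mathbb{R}$, and $\rho:P'\to P$ the isomorphism negating those coordinates; $\bar H(r)=H(\rho(r))$ if $r\in P'$; $\bar H(r)=\{X\}$ if $r\notin P'$ and there is $p\in P'$ with $p<r$; $\bar H(r)=\emptyset$ otherwise. For $\vec\epsilon\in\mathbb{R}_{\ge0}^n$, two HCs $H,E$ of the same set are $\vec\epsilon$-interleaved if $\bar H(\vec r)\preceq\bar E(\vec r+\vec\epsilon)$ and $\bar E(\vec r)\preceq\bar H(\vec r+\vec\epsilon)$ for all $\vec r\in\mathbb{R}^n$. A correspondence between $X$ and $Y$ is $R\subseteq X\times Y$ with surjective projections $\pi_X,\pi_Y$. For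 $\psi:Y\to X$, $\psi^*(\{C_i\})=\{\psi^{-1}(C_i)\}$ and $\psi^*(H)=\psi^*\circ H$. $H$ (of $X$) and $E$ (of $Y$) are $\vec\epsilon$-interleaved with respect to $R$ if $\pi_X^*(H),\pi_Y^*(E)$ are $\vec\epsilon$-interleaved. $d_{\mathrm{CI}}(H,E)$ is the infimum of $\epsilon\ge0$ such that $H,E$ are $(\epsilon,\dots,\epsilon)$-interleaved with respect to some correspondence. Metric probability spaces. A metric probability space is a metric space $\mathcal{M}$ with a Borel probability measure $\mu_{\mathcal{M}}$. For subsets of a metric space $Z$, $W^\epsilon=\{z:\exists w\in W, d_Z(z,w)<\epsilon\}$; $d_{\mathrm{H}}^Z(A,B)=\inf\{\epsilon>0: A\subseteq B^\epsilon, B\subseteq A^\epsilon\}$; $d_{\mathrm{P}}(\mu,\nu)=\inf\{\epsilon>0:\mu(A)\le\nu(A^\epsilon)+\epsilon,\ \nu(A)\le\mu(A^\epsilon)+\epsilon \text{ for all Borel } A\}$. For compact metric probability spaces, $d_{\mathrm{GHP}}(\mathcal{M},\mathcal{N})=\inf_{i,j}\max\big(d_{\mathrm{H}}^Z(i(\mathcal{M}),j(\mathcal{N})),d_{\mathrm{P}}(i_*\mu_{\mathcal{M}},j_*\mu_{\mathcal{N}})\big)$ over isometric embeddings $i,j$ of $\mathcal M,\mathcal N$ into a common metric space $Z$. Degree-Rips. For $s,k>0$ let $\mathrm{Uni}(\mathcal{M})_{[s,k]}=\{x\in\mathcal{M}:\mu_{\mathcal{M}}(B(x,s))\ge k\}$,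 where $B(x,s)$ is the open ball. For a metric space $M$ and $t>0$, $\mathrm{SL}(M)(t)$ is the partition of $M$ by the smallest equivalence relation with $x\sim y$ whenever $d_M(x,y)\le t$. The degree-Rips hierarchical clustering is the $2$-parameter HC $\mathrm{DR}(\mathcal{M}):\mathbb{R}_{>0}\times\mathbb{R}_{>0}^{\mathrm{op}}\to\mathsf{C}(\mathcal{M})$, $(s,k)\mapsto\mathrm{SL}(\mathrm{Uni}(\mathcal{M})_{[s,k]})(s)$. *)

theory Defs
  imports "HOL-Probability.Probability"
begin

section \<open>Hierarchical clusterings\<close>

definition clusterings :: "'a set \<Rightarrow> 'a set set set" where
  "clusterings X = {S. (\<forall>A\<in>S. A \<subseteq> X) \<and> {} \<notin> S \<and> disjoint S}"

definition refines_clustering :: "'a set set \<Rightarrow> 'a set set \<Rightarrow> bool" (infix \<open>\<preceq>\<^sub>C\<close> 50) where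
  "S \<preceq>\<^sub>C T \<longleftrightarrow> (\<forall>A\<in>S. \<exists>B\<in>T. A \<subseteq> B)"

text \<open>
  The raw data of a hierarchical clustering with parameters indexed by the finite type
  \<open>'n\<close>: the clustered set, the intervals \<open>I\<^sub>j\<close>, the set of those coordinates \<open>j\<close> for which
  \<open>I\<^sub>j\<close> carries the opposite order, and the map on the product of the intervals.
  Values of \<open>hc_map\<close> outside that product are irrelevant.
\<close>

record ('a, 'n::finite) hier_clust =
  hc_set :: "'a set"
  hc_ivl :: "'n \<Rightarrow> real set"
  hc_op  :: "'n set"
  hc_map :: "real ^ 'n \<Rightarrow> 'a set set"

definition hc_dom :: "('a, 'n::finite) hier_clust \<Rightarrow> (real ^ 'n) set" where
  "hc_dom H = {p. \<forall>j. p $ j \<in> hc_ivl H j}"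

definition hc_le :: "('a, 'n::finite) hier_clust \<Rightarrow> real ^ 'n \<Rightarrow> real ^ 'n \<Rightarrow> bool" where
  "hc_le H p q \<longleftrightarrow> (\<forall>j. if j \<in> hc_op H then q $ j \<le> p $ j else p $ j \<le> q $ j)"

definition hierarchical_clustering :: "('a, 'n::finite) hier_clust \<Rightarrow> bool" where
  "hierarchical_clustering H \<longleftrightarrow>
     (\<forall>j. is_interval (hc_ivl H j)) \<and>
     (\<forall>p\<in>hc_dom H. hc_map H p \<in> clusterings (hc_set H)) \<and>
     (\<forall>p\<in>hc_dom H. \<forall>q\<in>hc_dom H. hc_le H p q \<longrightarrow> hc_map H p \<preceq>\<^sub>C hc_map H q)"

definition hc_flip :: "('a, 'n::finite) hier_clust \<Rightarrow> real ^ 'n \<Rightarrow> real ^ 'n" where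
  "hc_flip H r = (\<chi> j. if j \<in> hc_op H then - r $ j else r $ j)"

text \<open>The domain \<open>P'\<close>, in which opposite intervals are replaced by their negatives.\<close>

definition hc_dom' :: "('a, 'n::finite) hier_clust \<Rightarrow> (real ^ 'n) set" where
  "hc_dom' H =
     {r. \<forall>j. r $ j \<in> (if j \<in> hc_op H then uminus ` hc_ivl H j else hc_ivl H j)}"

definition hc_ext :: "('a, 'n::finite) hier_clust \<Rightarrow> real ^ 'n \<Rightarrow> 'a set set" where
  "hc_ext H r =
     (if r \<in> hc_dom' H then hc_map H (hc_flip H r)
      else if \<exists>p\<in>hc_dom' H. p < r then {hc_set H}
      else {})"

definition interleaved ::
  "real ^ 'n \<Rightarrow> ('a, 'n::finite) hier_clust \<Rightarrow> ('a, 'n) hier_clust \<Rightarrow> bool" where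
  "interleaved \<epsilon> H E \<longleftrightarrow>
     (\<forall>r. hc_ext H r \<preceq>\<^sub>C hc_ext E (r + \<epsilon>) \<and> hc_ext E r \<preceq>\<^sub>C hc_ext H (r + \<epsilon>))"

definition hc_pullback ::
  "'b set \<Rightarrow> ('b \<Rightarrow> 'a) \<Rightarrow> ('a, 'n::finite) hier_clust \<Rightarrow> ('b, 'n) hier_clust" where
  "hc_pullback Y \<psi> H =
     \<lparr>hc_set = Y, hc_ivl = hc_ivl H, hc_op = hc_op H,
      hc_map = (\<lambda>p. (\<lambda>C. \<psi> -` C \<inter> Y) ` hc_map H p)\<rparr>"

definition correspondence :: "'a set \<Rightarrow> 'b set \<Rightarrow> ('a \<times> 'b) set \<Rightarrow> bool" where
  "correspondence X Y R \<longleftrightarrow> R \<subseteq> X \<times> Y \<and> fst ` R = X \<and> snd ` R = Y"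

definition interleaved_wrt ::
  "('a \<times> 'b) set \<Rightarrow> real ^ 'n \<Rightarrow> ('a, 'n::finite) hier_clust \<Rightarrow> ('b, 'n) hier_clust \<Rightarrow> bool" where
  "interleaved_wrt R \<epsilon> H E \<longleftrightarrow> interleaved \<epsilon> (hc_pullback R fst H) (hc_pullback R snd E)"

text \<open>
  All distances take values in \<open>[0, \<infinity>]\<close>, so that the infimum of the empty set is \<open>\<infinity>\<close>.
\<close>

definition dist_CI ::
  "('a, 'n::finite) hier_clust \<Rightarrow> ('b, 'n) hier_clust \<Rightarrow> ennreal" where
  "dist_CI H E =
     (INF \<epsilon>\<in>{\<epsilon>::real. 0 \<le> \<epsilon> \<and>
         (\<exists>R. correspondence (hc_set H) (hc_set E) R \<and> interleaved_wrt R (\<chi> _. \<epsilon>) H E)}.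
       ennreal \<epsilon>)"


section \<open>Metric probability spaces\<close>

definition borel_of :: "'a topology \<Rightarrow> 'a measure" where
  "borel_of T = sigma (topspace T) {U. openin T U}"

definition metric_prob_space :: "'a metric \<Rightarrow> 'a measure \<Rightarrow> bool" where
  "metric_prob_space M \<mu> \<longleftrightarrow>
     prob_space \<mu> \<and> space \<mu> = mspace M \<and> sets \<mu> = sets (borel_of (mtopology_of M))"

definition thicken :: "'a metric \<Rightarrow> 'a set \<Rightarrow> real \<Rightarrow> 'a set" where
  "thicken Z W \<epsilon> = {z \<in> mspace Z. \<exists>w\<in>W. mdist Z z w < \<epsilon>}"

definition dist_H :: "'a metric \<Rightarrow> 'a set \<Rightarrow> 'a set \<Rightarrow> ennreal" where
  "dist_H Z A B =
     (INF \<epsilon>\<in>{\<epsilon>::real. 0 < \<epsilon> \<and> A \<subseteq> thicken Z B \<epsilon> \<and> B \<subseteq> thicken Z A \<epsilon>}. ennreal \<epsilon>)"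

definition dist_P :: "'a metric \<Rightarrow> 'a measure \<Rightarrow> 'a measure \<Rightarrow> ennreal" where
  "dist_P Z \<mu> \<nu> =
     (INF \<epsilon>\<in>{\<epsilon>::real. 0 < \<epsilon> \<and>
         (\<forall>A\<in>sets (borel_of (mtopology_of Z)).
            emeasure \<mu> A \<le> emeasure \<nu> (thicken Z A \<epsilon>) + ennreal \<epsilon> \<and>
            emeasure \<nu> A \<le> emeasure \<mu> (thicken Z A \<epsilon>) + ennreal \<epsilon>)}.
       ennreal \<epsilon>)"

definition isometric_embedding :: "'a metric \<Rightarrow> 'z metric \<Rightarrow> ('a \<Rightarrow> 'z) \<Rightarrow> bool" where
  "isometric_embedding M Z i \<longleftrightarrow>
     i ` mspace M \<subseteq> mspace Z \<and>
     (\<forall>x\<in>mspace M. \<forall>y\<in>mspace M. mdist Z (i x) (i y) = mdist M x y)"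

text \<open>
  A definition in HOL cannot range over metric spaces of all types at once, so the type \<open>'z\<close>
  from which the points of the ambient space \<open>Z\<close> are drawn is a parameter; \<open>Z\<close> itself ranges
  over all metric spaces carried by arbitrary subsets of \<open>'z\<close>.  The
  Gromov--Hausdorff--Prokhorov distance is the infimum of these values over all \<open>'z\<close>; a lower
  bound for it is a number that is a lower bound for every choice of \<open>'z\<close>.
\<close>

definition dist_GHP ::
  "'z itself \<Rightarrow> 'a metric \<Rightarrow> 'a measure \<Rightarrow> 'b metric \<Rightarrow> 'b measure \<Rightarrow> ennreal" where
  "dist_GHP _ M \<mu> N \<nu> =
     (INF (Z, i, j)\<in>{(Z :: 'z metric, i, j).
                      isometric_embedding M Z i \<and> isometric_embedding N Z j}.
       max (dist_H Z (i ` mspace M) (j ` mspace N))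
           (dist_P Z (distr \<mu> (borel_of (mtopology_of Z)) i)
                     (distr \<nu> (borel_of (mtopology_of Z)) j)))"


section \<open>Degree-Rips\<close>

definition Uni :: "'a metric \<Rightarrow> 'a measure \<Rightarrow> real \<Rightarrow> real \<Rightarrow> 'a set" where
  "Uni M \<mu> s k = {x \<in> mspace M. measure \<mu> (mball_of M x s) \<ge> k}"

definition SL_rel :: "'a metric \<Rightarrow> real \<Rightarrow> ('a \<times> 'a) set" where
  "SL_rel M t =
     \<Inter>{r. equiv (mspace M) r \<and>
          (\<forall>x\<in>mspace M. \<forall>y\<in>mspace M. mdist M x y \<le> t \<longrightarrow> (x, y) \<in> r)}"

definition SL :: "'a metric \<Rightarrow> real \<Rightarrow> 'a set set" where
  "SL M t = mspace M // SL_rel M t"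

definition DR :: "'a metric \<Rightarrow> 'a measure \<Rightarrow> ('a, 2) hier_clust" where
  "DR M \<mu> =
     \<lparr>hc_set = mspace M, hc_ivl = (\<lambda>_. {0<..}), hc_op = {2},
      hc_map = (\<lambda>p. SL (submetric M (Uni M \<mu> (p $ 1) (p $ 2))) (p $ 1))\<rparr>"


section \<open>The constructions yield hierarchical clusterings\<close>

lemma equiv_SL_rel: "equiv (mspace M) (SL_rel M t)"
proof -
  let ?F = "{r. equiv (mspace M) r \<and>
          (\<forall>x\<in>mspace M. \<forall>y\<in>mspace M. mdist M x y \<le> t \<longrightarrow> (x, y) \<in> r)}"
  have top: "mspace M \<times> mspace M \<in> ?F"
    by (auto simp: equiv_def refl_on_def sym_def trans_def)
  show ?thesis
    unfolding SL_rel_def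
  proof (rule equivI)
    show "\<Inter>?F \<subseteq> mspace M \<times> mspace M"
      using top by (rule Inter_lower)
    show "refl_on (mspace M) (\<Inter>?F)"
      by (auto simp: equiv_def refl_on_def)
    show "sym (\<Inter>?F)"
      by (auto simp: equiv_def sym_def)
    show "trans (\<Inter>?F)"
      by (rule transI) (auto simp: equiv_def dest: transD)
  qed
qed

lemma SL_rel_mono:
  assumes "A \<subseteq> B" "s \<le> t"
  shows "SL_rel (submetric M A) s \<subseteq> SL_rel (submetric M B) t"
proof -
  let ?A = "A \<inter> mspace M" and ?B = "B \<inter> mspace M"
  let ?r = "SL_rel (submetric M B) t"
  have sub: "?A \<subseteq> ?B" using assms(1) by auto
  have eq: "equiv ?B ?r" using equiv_SL_rel[of "submetric M B" t] by simp
  have near: "(x, y) \<in> ?r" if "x \<in> ?B" "y \<in> ?B" "mdist M x y \<le> t" for x y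
    using that by (auto simp: SL_rel_def)
  have "equiv ?A (?r \<inter> ?A \<times> ?A)"
    using eq sub
    by (auto simp: equiv_def refl_on_def intro!: symI transI dest: symD transD)
  moreover have "(x, y) \<in> ?r \<inter> ?A \<times> ?A" if "x \<in> ?A" "y \<in> ?A" "mdist M x y \<le> s" for x y
    using near[of x y] that sub assms(2) by auto
  ultimately have "SL_rel (submetric M A) s \<subseteq> ?r \<inter> ?A \<times> ?A"
    unfolding SL_rel_def[of "submetric M A"] by (intro Inter_lower) auto
  then show ?thesis by blast
qed

lemma hierarchical_clustering_DR:
  assumes "metric_prob_space M \<mu>"
  shows "hierarchical_clustering (DR M \<mu>)"
proof -
  interpret prob_space \<mu> using assms by (simp add: metric_prob_space_def)
  have ball: "mball_of M x s \<in> sets \<mu>" for x s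
  proof -
    have "openin (mtopology_of M) (mball_of M x s)"
      by (simp add: mtopology_of_def mball_of_def Metric_space.openin_mball)
    then have "mball_of M x s \<in> sets (borel_of (mtopology_of M))"
      unfolding borel_of_def by (subst sets_measure_of) (use openin_subset in blast)+
    then show ?thesis using assms by (simp add: metric_prob_space_def)
  qed
  have Uni: "Uni M \<mu> s k \<subseteq> Uni M \<mu> s' k'" if "s \<le> s'" "k' \<le> k" for s s' k k'
  proof
    fix x assume "x \<in> Uni M \<mu> s k"
    moreover have "measure \<mu> (mball_of M x s) \<le> measure \<mu> (mball_of M x s')"
      using that by (intro finite_measure_mono ball) auto
    ultimately show "x \<in> Uni M \<mu> s' k'" using that by (auto simp: Uni_def)
  qed
  have clus: "SL (submetric M A) t \<in> clusterings (mspace M)" for A t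
  proof -
    let ?S = "submetric M A"
    have e: "equiv (mspace ?S) (SL_rel ?S t)" by (rule equiv_SL_rel)
    have "disjoint (SL ?S t)"
      unfolding SL_def disjoint_def using quotient_disj[OF e] by blast
    moreover have "{} \<notin> SL ?S t"
      unfolding SL_def using in_quotient_imp_non_empty[OF e] by blast
    moreover have "B \<subseteq> mspace M" if "B \<in> SL ?S t" for B
      using in_quotient_imp_subset[OF e] that unfolding SL_def by auto
    ultimately show ?thesis by (auto simp: clusterings_def)
  qed
  have ref: "SL (submetric M A) s \<preceq>\<^sub>C SL (submetric M B) t" if "A \<subseteq> B" "s \<le> t" for A B s t
    unfolding refines_clustering_def SL_def
  proof
    fix C assume "C \<in> mspace (submetric M A) // SL_rel (submetric M A) s"
    then obtain x where x: "x \<in> A \<inter> mspace M" "C = SL_rel (submetric M A) s `` {x}"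
      by (auto elim: quotientE)
    then have "C \<subseteq> SL_rel (submetric M B) t `` {x}" using SL_rel_mono[OF that] by auto
    moreover have "SL_rel (submetric M B) t `` {x}
        \<in> mspace (submetric M B) // SL_rel (submetric M B) t"
      using x that by (intro quotientI) auto
    ultimately show "\<exists>D\<in>mspace (submetric M B) // SL_rel (submetric M B) t. C \<subseteq> D" by blast
  qed
  have mono: "hc_map (DR M \<mu>) p \<preceq>\<^sub>C hc_map (DR M \<mu>) q" if "hc_le (DR M \<mu>) p q" for p q
  proof -
    have "p $ 1 \<le> q $ 1" "q $ 2 \<le> p $ 2"
      using that by (auto simp: DR_def hc_le_def forall_2)
    then show ?thesis
      by (simp add: DR_def ref Uni)
  qed
  have "is_interval (hc_ivl (DR M \<mu>) j)" for j
    by (simp add: DR_def is_interval_1)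
  moreover have "hc_map (DR M \<mu>) p \<in> clusterings (hc_set (DR M \<mu>))" for p
    using clus by (simp add: DR_def)
  ultimately show ?thesis
    unfolding hierarchical_clustering_def using mono by blast
qed

lemma clusterings_pullback:
  assumes "S \<in> clusterings (\<psi> ` Y)"
  shows "(\<lambda>C. \<psi> -` C \<inter> Y) ` S \<in> clusterings Y"
proof -
  have sub: "C \<subseteq> \<psi> ` Y" and ne: "C \<noteq> {}" if "C \<in> S" for C
    using assms that by (auto simp: clusterings_def)
  have disj: "C \<inter> D = {}" if "C \<in> S" "D \<in> S" "C \<noteq> D" for C D
    using assms that by (auto simp: clusterings_def dest: disjointD)
  have "\<psi> -` C \<inter> Y \<noteq> {}" if C: "C \<in> S" for C
  proof -
    obtain x where "x \<in> C" using ne[OF C] by auto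
    then obtain y where "y \<in> Y" "\<psi> y \<in> C" using sub[OF C] by auto
    then show ?thesis by auto
  qed
  moreover have "disjoint ((\<lambda>C. \<psi> -` C \<inter> Y) ` S)"
  proof (rule disjointI)
    fix A B assume "A \<in> (\<lambda>C. \<psi> -` C \<inter> Y) ` S" "B \<in> (\<lambda>C. \<psi> -` C \<inter> Y) ` S" "A \<noteq> B"
    then obtain C D where "C \<in> S" "D \<in> S" "C \<noteq> D" "A = \<psi> -` C \<inter> Y" "B = \<psi> -` D \<inter> Y"
      by blast
    then show "A \<inter> B = {}" using disj[of C D] by auto
  qed
  ultimately show ?thesis by (auto simp: clusterings_def)
qed

lemma refines_clustering_pullback:
  assumes "S \<preceq>\<^sub>C T"
  shows "(\<lambda>C. \<psi> -` C \<inter> Y) ` S \<preceq>\<^sub>C (\<lambda>C. \<psi> -` C \<inter> Y) ` T"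
  unfolding refines_clustering_def
proof
  fix A assume "A \<in> (\<lambda>C. \<psi> -` C \<inter> Y) ` S"
  then obtain C where C: "C \<in> S" "A = \<psi> -` C \<inter> Y" by auto
  then obtain D where "D \<in> T" "C \<subseteq> D" using assms by (auto simp: refines_clustering_def)
  with C show "\<exists>B\<in>(\<lambda>C. \<psi> -` C \<inter> Y) ` T. A \<subseteq> B" by (intro bexI[of _ "\<psi> -` D \<inter> Y"]) auto
qed

lemma hierarchical_clustering_pullback:
  assumes H: "hierarchical_clustering H" and \<psi>: "\<psi> ` Y = hc_set H"
  shows "hierarchical_clustering (hc_pullback Y \<psi> H)"
proof -
  have [simp]: "hc_dom (hc_pullback Y \<psi> H) = hc_dom H"
    by (simp add: hc_pullback_def hc_dom_def)
  have [simp]: "hc_le (hc_pullback Y \<psi> H) p q = hc_le H p q" for p q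
    by (simp add: hc_pullback_def hc_le_def)
  have [simp]: "hc_ivl (hc_pullback Y \<psi> H) = hc_ivl H" "hc_set (hc_pullback Y \<psi> H) = Y"
    "hc_map (hc_pullback Y \<psi> H) p = (\<lambda>C. \<psi> -` C \<inter> Y) ` hc_map H p" for p
    by (simp_all add: hc_pullback_def)
  show ?thesis
    using H unfolding hierarchical_clustering_def
    by (simp add: clusterings_pullback refines_clustering_pullback \<psi>)
qed

end

theory Submission
  imports Defs
begin

text \<open>
  Fix a common ambient space \<open>Z\<close> and \<open>\<epsilon>\<close> larger than both the Hausdorff and the Prokhorov
  distance in \<open>Z\<close>, and relate \<open>x\<close> and \<open>y\<close> whenever their images in \<open>Z\<close> are less than \<open>\<epsilon>\<close>
  apart. Passing from \<open>x\<close> to a related \<open>y\<close> changes distances by at most \<open>2\<epsilon>\<close>. The Prokhorov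
  inequality for the ball of radius \<open>s\<close> about \<open>x\<close> costs \<open>\<epsilon>\<close> in the radius and \<open>\<epsilon>\<close> in the mass,
  and moving the centre to \<open>y\<close> costs another \<open>\<epsilon>\<close> in the radius. So single-linkage chains of
  points with many neighbours are carried to such chains with both parameters relaxed by \<open>2\<epsilon>\<close>.
\<close>

section \<open>Single-linkage chains along two maps out of one set\<close>

text \<open>\<open>SL_rel\<close> is the smallest equivalence containing the short pairs, so it
  suffices to find one equivalence that contains them and whose pairs have related
  \<open>g\<close>-images. Keeping \<open>f\<close> and \<open>g\<close> as abstract maps on
  \<open>R\<close> lets both directions of the interleaving use the same argument.\<close>

lemma SL_rel_transfer:
  assumes surj: "A \<inter> mspace M \<subseteq> f ` R"
    and into: "\<And>q. q \<in> R \<Longrightarrow> f q \<in> A \<Longrightarrow> g q \<in> B \<inter> mspace N"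
    and near: "\<And>q q'. q \<in> R \<Longrightarrow> q' \<in> R \<Longrightarrow> f q \<in> A \<inter> mspace M \<Longrightarrow> f q' \<in> A \<inter> mspace M \<Longrightarrow>
      mdist M (f q) (f q') \<le> s \<Longrightarrow> mdist N (g q) (g q') \<le> t"
    and s: "0 \<le> s"
    and q: "q \<in> R" "q' \<in> R" "(f q, f q') \<in> SL_rel (submetric M A) s"
  shows "(g q, g q') \<in> SL_rel (submetric N B) t"
proof -
  let ?A = "A \<inter> mspace M" and ?E = "SL_rel (submetric N B) t"
  have E: "equiv (B \<inter> mspace N) ?E" using equiv_SL_rel[of "submetric N B" t] by simp
  have E_near: "(g p, g p') \<in> ?E"
    if "p \<in> R" "p' \<in> R" "f p \<in> ?A" "f p' \<in> ?A" "mdist M (f p) (f p') \<le> s" for p p'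
    using into near that by (auto simp: SL_rel_def)
  \<comment> \<open>Quantifying over all lifts, rather than choosing one for each point, gives the
    conclusion for the prescribed \<open>q\<close> and \<open>q'\<close>.\<close>
  define r where "r = {(x, x'). x \<in> ?A \<and> x' \<in> ?A \<and>
    (\<forall>p\<in>R. \<forall>p'\<in>R. f p = x \<longrightarrow> f p' = x' \<longrightarrow> (g p, g p') \<in> ?E)}"
  have "equiv ?A r"
  proof (rule equivI)
    show "r \<subseteq> ?A \<times> ?A" by (auto simp: r_def)
    show "refl_on ?A r"
    proof (rule refl_onI)
      fix x assume x: "x \<in> ?A"
      \<comment> \<open>Reflexivity is not automatic: two lifts of \<open>x\<close> may have
        different \<open>g\<close>-images. They are related because their \<open>f\<close>-images
        are at distance 0, which is at most \<open>s\<close>.\<close>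
      then have "mdist M x x = 0" by simp
      then have "mdist M x x \<le> s" using s by simp
      then show "(x, x) \<in> r" using x E_near by (auto simp: r_def)
    qed
    show "sym r" by (rule symI) (use E in \<open>auto simp: r_def equiv_def dest: symD\<close>)
    show "trans r"
    proof (rule transI)
      fix x y z assume xy: "(x, y) \<in> r" and yz: "(y, z) \<in> r"
      \<comment> \<open>Surjectivity matters here: without a lift of the middle point the two links
        could not be joined.\<close>
      then obtain p where p: "p \<in> R" "f p = y" using surj by (auto simp: r_def)
      have "(g q, g q') \<in> ?E" if "q \<in> R" "q' \<in> R" "f q = x" "f q' = z" for q q'
      proof -
        have "(g q, g p) \<in> ?E" "(g p, g q') \<in> ?E"
          using xy yz p that unfolding r_def by blast+
        then show ?thesis using E unfolding equiv_def by (blast dest: transD)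
      qed
      then show "(x, z) \<in> r" using xy yz by (auto simp: r_def)
    qed
  qed
  moreover have "(x, x') \<in> r" if "x \<in> ?A" "x' \<in> ?A" "mdist M x x' \<le> s" for x x'
    using that E_near by (auto simp: r_def)
  ultimately have "SL_rel (submetric M A) s \<subseteq> r"
    unfolding SL_rel_def[of "submetric M A"] by (intro Inter_lower) auto
  then show ?thesis using q by (auto simp: r_def)
qed

text \<open>Any lift \<open>q\<close> of a point \<open>x\<close> of a block selects the receiving
  block, namely the class of \<open>g q\<close>.\<close>

lemma SL_pullback_refines:
  assumes "A \<inter> mspace M \<subseteq> f ` R"
    and into: "\<And>q. q \<in> R \<Longrightarrow> f q \<in> A \<Longrightarrow> g q \<in> B \<inter> mspace N"
    and "\<And>q q'. q \<in> R \<Longrightarrow> q' \<in> R \<Longrightarrow> f q \<in> A \<inter> mspace M \<Longrightarrow> f q' \<in> A \<inter> mspace M \<Longrightarrow>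
      mdist M (f q) (f q') \<le> s \<Longrightarrow> mdist N (g q) (g q') \<le> t"
    and "0 \<le> s"
  shows "(\<lambda>C. f -` C \<inter> R) ` SL (submetric M A) s \<preceq>\<^sub>C (\<lambda>C. g -` C \<inter> R) ` SL (submetric N B) t"
  unfolding refines_clustering_def
proof
  fix C assume "C \<in> (\<lambda>C. f -` C \<inter> R) ` SL (submetric M A) s"
  then obtain x where x: "x \<in> A \<inter> mspace M"
    and C: "C = f -` (SL_rel (submetric M A) s `` {x}) \<inter> R"
    by (auto simp: SL_def elim!: quotientE)
  obtain q where q: "q \<in> R" "f q = x" using assms(1) x by auto
  let ?D = "SL_rel (submetric N B) t `` {g q}"
  have "?D \<in> SL (submetric N B) t"
    unfolding SL_def using into[OF q(1)] q x by (intro quotientI) auto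
  moreover have "C \<subseteq> g -` ?D \<inter> R"
  proof -
    have "(g q, g q') \<in> SL_rel (submetric N B) t"
      if "q' \<in> R" "(x, f q') \<in> SL_rel (submetric M A) s" for q'
      by (rule SL_rel_transfer[where M = M and A = A and f = f and R = R and s = s])
        (use assms q that in auto)
    then show ?thesis unfolding C by auto
  qed
  ultimately show "\<exists>D\<in>(\<lambda>C. g -` C \<inter> R) ` SL (submetric N B) t. C \<subseteq> D" by blast
qed

section \<open>One direction of the interleaving, including the default values of the
  extension\<close>

lemma hc_dom'_pullback_DR:
  "r \<in> hc_dom' (hc_pullback R f (DR M \<mu>)) \<longleftrightarrow> 0 < r $ 1 \<and> r $ 2 < 0"
proof -
  have "r $ 2 \<in> uminus ` {0<..} \<longleftrightarrow> r $ 2 < 0" by simp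
  then show ?thesis
    by (simp add: hc_dom'_def hc_pullback_def DR_def forall_2)
qed

lemma hc_map_pullback_DR:
  "hc_map (hc_pullback R f (DR M \<mu>)) (hc_flip (hc_pullback R f (DR M \<mu>)) r) =
     (\<lambda>C. f -` C \<inter> R) ` SL (submetric M (Uni M \<mu> (r $ 1) (- r $ 2))) (r $ 1)"
  by (simp add: hc_pullback_def DR_def hc_flip_def)

text \<open>The hypotheses isolate what one direction needs: distances grow by at most \<delta>, and
  ball masses survive up to \<delta> in radius and in mass. The other direction exchanges
  \<open>f\<close> and \<open>g\<close>.\<close>

lemma DR_pullback_refines:
  fixes r :: "real ^ 2"
  assumes \<delta>: "0 < \<delta>"
    and surj: "mspace M \<subseteq> f ` R"
    and into: "g ` R \<subseteq> mspace N"
    and dist: "\<And>q q'. q \<in> R \<Longrightarrow> q' \<in> R \<Longrightarrow>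
      mdist N (g q) (g q') \<le> mdist M (f q) (f q') + \<delta>"
    and meas: "\<And>q s. q \<in> R \<Longrightarrow>
      measure \<mu> (mball_of M (f q) s) \<le> measure \<nu> (mball_of N (g q) (s + \<delta>)) + \<delta>"
  shows "hc_ext (hc_pullback R f (DR M \<mu>)) r
    \<preceq>\<^sub>C hc_ext (hc_pullback R g (DR N \<nu>)) (r + (\<chi> _. \<delta>))"
proof -
  let ?H = "hc_pullback R f (DR M \<mu>)" and ?E = "hc_pullback R g (DR N \<nu>)"
  let ?r = "r + (\<chi> _. \<delta>)"
  have less: "r < ?r" using \<delta> by (auto simp: less_vec_def less_eq_vec_def)
  have [simp]: "hc_set ?H = R" "hc_set ?E = R" by (simp_all add: hc_pullback_def)
  have same: "hc_dom' ?E = hc_dom' ?H" by (simp add: set_eq_iff hc_dom'_pullback_DR)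
  show ?thesis
  proof (cases "r \<in> hc_dom' ?H")
    case r: True
    show ?thesis
    proof (cases "?r \<in> hc_dom' ?E")
      case True
      have near: "mdist N (g q) (g q') \<le> r $ 1 + \<delta>"
        if "q \<in> R" "q' \<in> R" "mdist M (f q) (f q') \<le> r $ 1" for q q'
        using dist[OF that(1,2)] that(3) by simp
      \<comment> \<open>The second coordinate is negated, so shifting it up by \<delta> lowers the
        mass threshold \<open>- r $ 2\<close> by \<delta>.\<close>
      have "g q \<in> Uni N \<nu> (r $ 1 + \<delta>) (- r $ 2 - \<delta>)"
        if "q \<in> R" "f q \<in> Uni M \<mu> (r $ 1) (- r $ 2)" for q
        using meas[OF that(1), of "r $ 1"] that into by (auto simp: Uni_def)
      then have "(\<lambda>C. f -` C \<inter> R) ` SL (submetric M (Uni M \<mu> (r $ 1) (- r $ 2))) (r $ 1)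
          \<preceq>\<^sub>C (\<lambda>C. g -` C \<inter> R) `
            SL (submetric N (Uni N \<nu> (r $ 1 + \<delta>) (- r $ 2 - \<delta>))) (r $ 1 + \<delta>)"
        using surj into r near
        by (intro SL_pullback_refines) (auto simp: hc_dom'_pullback_DR)
      then show ?thesis
        using r True unfolding hc_ext_def
        by (simp add: hc_map_pullback_DR)
    next
      \<comment> \<open>The threshold has dropped to 0 or below. As \<open>r\<close> lies strictly
        below \<open>?r\<close>, the extension takes the default \<open>{R}\<close>, whose single
        block contains every pulled-back block.\<close>
      case False
      moreover have "\<exists>p\<in>hc_dom' ?E. p < ?r" using r less same by blast
      ultimately have "hc_ext ?E ?r = {R}" by (simp add: hc_ext_def)
      then show ?thesis
        using r by (auto simp: hc_ext_def hc_map_pullback_DR refines_clustering_def)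
    qed
  next
    case r: False
    show ?thesis
    proof (cases "\<exists>p\<in>hc_dom' ?H. p < r")
      case True
      then obtain p where p: "p \<in> hc_dom' ?H" "p < r" by blast
      \<comment> \<open>Now \<open>r $ 1\<close> is positive, so \<open>r\<close> misses the domain
        because \<open>r $ 2 \<ge> 0\<close>. This persists after the shift, and both sides equal
        \<open>{R}\<close>.\<close>
      have "p $ 1 \<le> r $ 1" using p(2) by (simp add: less_vec_def less_eq_vec_def)
      then have "?r \<notin> hc_dom' ?E" using p(1) r \<delta> by (auto simp: hc_dom'_pullback_DR)
      moreover have "p < ?r" using p(2) less by (rule less_trans)
      ultimately show ?thesis
        using p r by (auto simp: hc_ext_def same refines_clustering_def)
    next
      case False
      then show ?thesis using r by (simp add: hc_ext_def refines_clustering_def)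
    qed
  qed
qed

section \<open>Borel sets, pushforward measures and ball masses in the ambient space\<close>

lemma space_borel_of [simp]: "space (borel_of T) = topspace T"
  unfolding borel_of_def by (rule space_measure_of) (use openin_subset in blast)

lemma openin_imp_sets_borel_of: "openin T U \<Longrightarrow> U \<in> sets (borel_of T)"
  unfolding borel_of_def by (subst sets_measure_of) (use openin_subset in blast)+

lemma mball_of_sets: "mball_of M x s \<in> sets (borel_of (mtopology_of M))"
  by (rule openin_imp_sets_borel_of)
    (simp add: mtopology_of_def mball_of_def Metric_space.openin_mball)

lemma continuous_map_measurable_borel_of:
  assumes "continuous_map T T' h"
  shows "h \<in> borel_of T \<rightarrow>\<^sub>M borel_of T'"
  unfolding borel_of_def[of T']
proof (rule measurable_measure_of)
  show "{U. openin T' U} \<subseteq> Pow (topspace T')" using openin_subset by blast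
  show "h \<in> space (borel_of T) \<rightarrow> topspace T'"
    using assms by (auto simp: continuous_map_def)
  fix U assume "U \<in> {U. openin T' U}"
  then have "openin T {x \<in> topspace T. h x \<in> U}"
    using assms by (simp add: continuous_map_def)
  moreover have "h -` U \<inter> space (borel_of T) = {x \<in> topspace T. h x \<in> U}" by auto
  ultimately show "h -` U \<inter> space (borel_of T) \<in> sets (borel_of T)"
    by (simp add: openin_imp_sets_borel_of)
qed

lemma isometric_embedding_measurable:
  assumes "metric_prob_space M \<mu>" "isometric_embedding M Z i"
  shows "i \<in> \<mu> \<rightarrow>\<^sub>M borel_of (mtopology_of Z)"
proof -
  have "continuous_map (mtopology_of M) (mtopology_of Z) i"
  proof (rule Lipschitz_continuous_imp_continuous_map)
    show "Lipschitz_continuous_map M Z i"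
      unfolding Lipschitz_continuous_map_def
      using assms(2) by (auto simp: isometric_embedding_def intro!: exI[of _ 1])
  qed
  then have "i \<in> borel_of (mtopology_of M) \<rightarrow>\<^sub>M borel_of (mtopology_of Z)"
    by (rule continuous_map_measurable_borel_of)
  then show ?thesis
    using assms(1) by (subst measurable_cong_sets[OF _ refl]) (auto simp: metric_prob_space_def)
qed

text \<open>An isometric embedding pulls a ball centred at an image point back to the ball of the
  same radius, so masses of balls in \<open>M\<close> can be read off in \<open>Z\<close>.\<close>

lemma emeasure_distr_mball:
  assumes M: "metric_prob_space M \<mu>" and i: "isometric_embedding M Z i" and x: "x \<in> mspace M"
  shows "emeasure (distr \<mu> (borel_of (mtopology_of Z)) i) (mball_of Z (i x) s)
    = emeasure \<mu> (mball_of M x s)"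
proof -
  have "i -` mball_of Z (i x) s \<inter> space \<mu> = mball_of M x s"
    using M i x by (auto simp: metric_prob_space_def isometric_embedding_def image_subset_iff)
  then show ?thesis
    using emeasure_distr[OF isometric_embedding_measurable[OF M i] mball_of_sets] by simp
qed

text \<open>The Prokhorov inequality is applied to the ball about \<open>i x\<close>, whose
  thickening lies in a larger ball about \<open>j y\<close>.\<close>

lemma measure_mball_le_of_prokhorov:
  assumes M: "metric_prob_space M \<mu>" and N: "metric_prob_space N \<nu>"
    and i: "isometric_embedding M Z i" and j: "isometric_embedding N Z j"
    and x: "x \<in> mspace M" and y: "y \<in> mspace N" and xy: "mdist Z (i x) (j y) < \<epsilon>"
    and \<eta>: "\<eta> \<le> \<epsilon>" "0 < \<eta>"
    and P: "\<And>A. A \<in> sets (borel_of (mtopology_of Z)) \<Longrightarrow>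
      emeasure (distr \<mu> (borel_of (mtopology_of Z)) i) A
        \<le> emeasure (distr \<nu> (borel_of (mtopology_of Z)) j) (thicken Z A \<eta>) + ennreal \<eta>"
  shows "measure \<mu> (mball_of M x s) \<le> measure \<nu> (mball_of N y (s + 2 * \<epsilon>)) + 2 * \<epsilon>"
proof -
  interpret \<mu>: prob_space \<mu> using M by (simp add: metric_prob_space_def)
  interpret \<nu>: prob_space \<nu> using N by (simp add: metric_prob_space_def)
  let ?\<nu>Z = "distr \<nu> (borel_of (mtopology_of Z)) j"
  have ix: "i x \<in> mspace Z" and jy: "j y \<in> mspace Z"
    using i j x y by (auto simp: isometric_embedding_def)
  have sub: "thicken Z (mball_of Z (i x) s) \<eta> \<subseteq> mball_of Z (j y) (s + 2 * \<epsilon>)"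
  proof
    fix z assume "z \<in> thicken Z (mball_of Z (i x) s) \<eta>"
    then obtain w where z: "z \<in> mspace Z" and w: "w \<in> mspace Z" "mdist Z (i x) w < s"
      and zw: "mdist Z z w < \<eta>" by (auto simp: thicken_def)
    \<comment> \<open>The path from \<open>j y\<close> through \<open>i x\<close> and
      \<open>w\<close> to \<open>z\<close> has legs below \<epsilon>, \<open>s\<close> and \<eta>,
      with \<eta> at most \<epsilon>.\<close>
    have "mdist Z (j y) z \<le> mdist Z (j y) (i x) + (mdist Z (i x) w + mdist Z w z)"
      using mdist_triangle[OF jy ix z] mdist_triangle[OF ix w(1) z] by simp
    also have "\<dots> < s + 2 * \<epsilon>"
      using w(2) zw xy \<eta> by (simp add: mdist_commute)
    finally show "z \<in> mball_of Z (j y) (s + 2 * \<epsilon>)" using z jy by simp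
  qed
  have "emeasure \<mu> (mball_of M x s)
      \<le> emeasure ?\<nu>Z (thicken Z (mball_of Z (i x) s) \<eta>) + ennreal \<eta>"
    using P[OF mball_of_sets] emeasure_distr_mball[OF M i x] by metis
  also have "emeasure ?\<nu>Z (thicken Z (mball_of Z (i x) s) \<eta>)
      \<le> emeasure ?\<nu>Z (mball_of Z (j y) (s + 2 * \<epsilon>))"
    using sub by (rule emeasure_mono) (simp add: mball_of_sets)
  also have "\<dots> = emeasure \<nu> (mball_of N y (s + 2 * \<epsilon>))"
    by (rule emeasure_distr_mball[OF N j y])
  finally have "ennreal (measure \<mu> (mball_of M x s))
      \<le> ennreal (measure \<nu> (mball_of N y (s + 2 * \<epsilon>)) + \<eta>)"
    using \<eta> by (simp add: \<mu>.emeasure_eq_measure \<nu>.emeasure_eq_measure add_mono ennreal_plus)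
  then have "measure \<mu> (mball_of M x s) \<le> measure \<nu> (mball_of N y (s + 2 * \<epsilon>)) + \<eta>"
    using \<eta> by (subst (asm) ennreal_le_iff) auto
  \<comment> \<open>The mass loss is only \<eta>; it is weakened so that radius and mass share one
    shift.\<close>
  then show ?thesis using \<eta> by linarith
qed

section \<open>The correspondence of nearby points and passage to the infimum\<close>

lemma mdist_perturb:
  assumes "a \<in> mspace Z" "a' \<in> mspace Z" "b \<in> mspace Z" "b' \<in> mspace Z"
    and "mdist Z a b < \<epsilon>" "mdist Z a' b' < \<epsilon>"
  shows "mdist Z b b' \<le> mdist Z a a' + 2 * \<epsilon>"
  using mdist_triangle[of b Z a b'] mdist_triangle[of a Z a' b'] assms
  by (simp add: mdist_commute)

text \<open>The strict bounds let each infimum supply its own witness, \<open>h\<close> for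
  Hausdorff and \<eta> for Prokhorov, neither exceeding the common \<epsilon> that defines the
  correspondence.\<close>

lemma dist_CI_DR_le:
  assumes M: "metric_prob_space M \<mu>" and N: "metric_prob_space N \<nu>"
    and i: "isometric_embedding M Z i" and j: "isometric_embedding N Z j"
    and \<epsilon>: "dist_H Z (i ` mspace M) (j ` mspace N) < ennreal \<epsilon>"
      "dist_P Z (distr \<mu> (borel_of (mtopology_of Z)) i)
         (distr \<nu> (borel_of (mtopology_of Z)) j) < ennreal \<epsilon>"
  shows "dist_CI (DR M \<mu>) (DR N \<nu>) \<le> ennreal (2 * \<epsilon>)"
proof -
  obtain h where h: "h < \<epsilon>" "0 < h"
    "i ` mspace M \<subseteq> thicken Z (j ` mspace N) h" "j ` mspace N \<subseteq> thicken Z (i ` mspace M) h"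
    using \<epsilon>(1) unfolding dist_H_def INF_less_iff by (auto simp: ennreal_less_iff)
  obtain \<eta> where \<eta>: "\<eta> \<le> \<epsilon>" "0 < \<eta>" and P: "\<And>A. A \<in> sets (borel_of (mtopology_of Z)) \<Longrightarrow>
      emeasure (distr \<mu> (borel_of (mtopology_of Z)) i) A
        \<le> emeasure (distr \<nu> (borel_of (mtopology_of Z)) j) (thicken Z A \<eta>) + ennreal \<eta>"
      "\<And>A. A \<in> sets (borel_of (mtopology_of Z)) \<Longrightarrow>
      emeasure (distr \<nu> (borel_of (mtopology_of Z)) j) A
        \<le> emeasure (distr \<mu> (borel_of (mtopology_of Z)) i) (thicken Z A \<eta>) + ennreal \<eta>"
  proof -
    obtain \<eta> where "0 < \<eta>" "ennreal \<eta> < ennreal \<epsilon>"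
      "\<forall>A\<in>sets (borel_of (mtopology_of Z)).
        emeasure (distr \<mu> (borel_of (mtopology_of Z)) i) A
          \<le> emeasure (distr \<nu> (borel_of (mtopology_of Z)) j) (thicken Z A \<eta>) + ennreal \<eta> \<and>
        emeasure (distr \<nu> (borel_of (mtopology_of Z)) j) A
          \<le> emeasure (distr \<mu> (borel_of (mtopology_of Z)) i) (thicken Z A \<eta>) + ennreal \<eta>"
      using \<epsilon>(2) unfolding dist_P_def INF_less_iff by blast
    then show thesis by (intro that[of \<eta>]) (auto simp: ennreal_less_iff)
  qed
  have pos: "0 < 2 * \<epsilon>" using h by simp
  define R where "R = {(x, y). x \<in> mspace M \<and> y \<in> mspace N \<and> mdist Z (i x) (j y) < \<epsilon>}"
  have R: "fst q \<in> mspace M" "snd q \<in> mspace N" "mdist Z (i (fst q)) (j (snd q)) < \<epsilon>"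
    "mdist Z (j (snd q)) (i (fst q)) < \<epsilon>" if "q \<in> R" for q
    using that by (auto simp: R_def mdist_commute)
  have in_Z: "i x \<in> mspace Z" "j y \<in> mspace Z" if "x \<in> mspace M" "y \<in> mspace N" for x y
    using i j that by (auto simp: isometric_embedding_def)
  have iso: "mdist Z (i x) (i x') = mdist M x x'" if "x \<in> mspace M" "x' \<in> mspace M" for x x'
    using i that by (simp add: isometric_embedding_def)
  have jso: "mdist Z (j y) (j y') = mdist N y y'" if "y \<in> mspace N" "y' \<in> mspace N" for y y'
    using j that by (simp add: isometric_embedding_def)
  \<comment> \<open>The Hausdorff witness provides a partner for every point, within
    \<open>h < \<epsilon>\<close>.\<close>
  have fst_R: "mspace M \<subseteq> fst ` R"
  proof
    fix x assume x: "x \<in> mspace M"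
    then obtain y where "y \<in> mspace N" "mdist Z (i x) (j y) < h"
      using h(3) by (auto simp: thicken_def)
    then show "x \<in> fst ` R" using x h(1) by (auto simp: R_def image_iff intro!: exI[of _ y])
  qed
  have snd_R: "mspace N \<subseteq> snd ` R"
  proof
    fix y assume y: "y \<in> mspace N"
    then obtain x where "x \<in> mspace M" "mdist Z (j y) (i x) < h"
      using h(4) by (auto simp: thicken_def)
    then show "y \<in> snd ` R"
      using y h(1) by (auto simp: R_def image_iff mdist_commute intro!: exI[of _ x])
  qed
  have "correspondence (hc_set (DR M \<mu>)) (hc_set (DR N \<nu>)) R"
    using fst_R snd_R by (auto simp: correspondence_def DR_def R_def)
  moreover have "interleaved_wrt R (\<chi> _. 2 * \<epsilon>) (DR M \<mu>) (DR N \<nu>)"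
    unfolding interleaved_wrt_def interleaved_def
  proof (intro allI conjI)
    fix r :: "real ^ 2"
    show "hc_ext (hc_pullback R fst (DR M \<mu>)) r
        \<preceq>\<^sub>C hc_ext (hc_pullback R snd (DR N \<nu>)) (r + (\<chi> _. 2 * \<epsilon>))"
    proof (rule DR_pullback_refines[OF pos fst_R])
      show "snd ` R \<subseteq> mspace N" by (auto simp: R_def)
      show "mdist N (snd q) (snd q') \<le> mdist M (fst q) (fst q') + 2 * \<epsilon>"
        if "q \<in> R" "q' \<in> R" for q q'
        using mdist_perturb[of "i (fst q)" Z "i (fst q')" "j (snd q)" "j (snd q')" \<epsilon>]
          R[OF that(1)] R[OF that(2)] in_Z iso jso by simp
      show "measure \<mu> (mball_of M (fst q) s)
          \<le> measure \<nu> (mball_of N (snd q) (s + 2 * \<epsilon>)) + 2 * \<epsilon>" if "q \<in> R" for q s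
        using measure_mball_le_of_prokhorov[OF M N i j R(1,2,3)[OF that] \<eta> P(1)] .
    qed
    show "hc_ext (hc_pullback R snd (DR N \<nu>)) r
        \<preceq>\<^sub>C hc_ext (hc_pullback R fst (DR M \<mu>)) (r + (\<chi> _. 2 * \<epsilon>))"
    proof (rule DR_pullback_refines[OF pos snd_R])
      show "fst ` R \<subseteq> mspace M" by (auto simp: R_def)
      show "mdist M (fst q) (fst q') \<le> mdist N (snd q) (snd q') + 2 * \<epsilon>"
        if "q \<in> R" "q' \<in> R" for q q'
        using mdist_perturb[of "j (snd q)" Z "j (snd q')" "i (fst q)" "i (fst q')" \<epsilon>]
          R[OF that(1)] R[OF that(2)] in_Z iso jso by simp
      show "measure \<nu> (mball_of N (snd q) s)
          \<le> measure \<mu> (mball_of M (fst q) (s + 2 * \<epsilon>)) + 2 * \<epsilon>" if "q \<in> R" for q s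
        using measure_mball_le_of_prokhorov[OF N M j i R(2,1,4)[OF that] \<eta> P(2)] .
    qed
  qed
  ultimately show ?thesis
    unfolding dist_CI_def using pos by (intro INF_lower2[of "2 * \<epsilon>"]) auto
qed

text \<open>An infimum need not be attained, so the estimate is made at every real above
  \<open>g\<close> and then passed to the limit.\<close>

lemma ennreal_le_mult2I:
  fixes c g :: ennreal
  assumes "\<And>\<epsilon>::real. g < ennreal \<epsilon> \<Longrightarrow> c \<le> ennreal (2 * \<epsilon>)"
  shows "c \<le> 2 * g"
proof (cases g)
  case (real x)
  have "c \<le> ennreal (2 * x)"
  proof (rule ennreal_le_epsilon)
    fix e :: real assume "0 < e"
    \<comment> \<open>Half of \<open>e\<close> is added because the bound doubles it.\<close>
    then have "c \<le> ennreal (2 * (x + e / 2))"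
      using real by (intro assms) (simp add: ennreal_less_iff)
    also have "\<dots> = ennreal (2 * x) + ennreal e"
      using real \<open>0 < e\<close> by (simp add: ennreal_plus distrib_left)
    finally show "c \<le> ennreal (2 * x) + ennreal e" .
  qed
  then show ?thesis using real by (simp add: ennreal_mult)
next
  \<comment> \<open>This includes an ambient type \<open>'z\<close> into which the two spaces have
    no common embedding.\<close>
  case top
  then show ?thesis by (simp add: ennreal_mult_top)
qed

text \<open>Since \<open>'z\<close> is arbitrary, the bound passes to the infimum over all ambient
  types.\<close>

theorem corollary39:
  fixes M :: "'a metric" and \<mu> :: "'a measure"
    and N :: "'b metric" and \<nu> :: "'b measure"
  assumes "metric_prob_space M \<mu>" and "compact_space (mtopology_of M)"
    and "metric_prob_space N \<nu>" and "compact_space (mtopology_of N)"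
  shows "dist_CI (DR M \<mu>) (DR N \<nu>) \<le> 2 * dist_GHP TYPE('z) M \<mu> N \<nu>"
proof (rule ennreal_le_mult2I)
  fix \<epsilon> :: real assume "dist_GHP TYPE('z) M \<mu> N \<nu> < ennreal \<epsilon>"
  then obtain Z :: "'z metric" and i j
    where "isometric_embedding M Z i" "isometric_embedding N Z j"
      "dist_H Z (i ` mspace M) (j ` mspace N) < ennreal \<epsilon>"
      "dist_P Z (distr \<mu> (borel_of (mtopology_of Z)) i)
         (distr \<nu> (borel_of (mtopology_of Z)) j) < ennreal \<epsilon>"
    unfolding dist_GHP_def INF_less_iff by auto
  then show "dist_CI (DR M \<mu>) (DR N \<nu>) \<le> ennreal (2 * \<epsilon>)"
    by (rule dist_CI_DR_le[OF assms(1,3)])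
qed

end
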